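(* Let $n\geq 4$ be an integer, and let $\alpha\in \mathrm{PLat}(n)$ be a partition of height $1$ or $2$. Then there exist $\beta,\gamma,\delta\in\mathrm{PLat}(n)$ such that $\{\alpha,\beta,\gamma,\delta\}$ is a four-element generating set of the lattice $\mathrm{PLat}(n)$.
   Context: For a set $A$, $\mathrm{PLat}(A)$ denotes the lattice of all partitions of $A$, ordered by: $\alpha\leq\beta$ iff the equivalence relation determined by $\alpha$ is contained in the equivalence relation determined by $\beta$. For a positive integer $n$, $[n]=\{1,\dots,n\}$ and $\mathrm{PLat}(n):=\mathrm{PLat}([n])$. A subset $X$ of a lattice $L$ is a generating set of $L$ if no proper sublattice of $L$ (closed under binary joins and meets) includes $X$. A partition has height $1$ (is an atom) if it has exactly one two-element block and all its other blocks are singletons. A partition has height $2$ if it is the join of two distinct atoms; equivalently, either it has exactly two two-element blocks and all other blocks are singletons, or it has exactly one three-element block and all other blocks are singletons. "Four-element" means that the four listed partitions are pairwise distinct. *)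

theory Defs
  imports "HOL-Algebra.Lattice" "HOL-Library.Disjoint_Sets"
begin

definition eqrel_of :: "'a set set \<Rightarrow> 'a rel" where
  "eqrel_of P = {(x, y). \<exists>B\<in>P. x \<in> B \<and> y \<in> B}"

definition PLat :: "'a set \<Rightarrow> 'a set set gorder" where
  "PLat A = \<lparr>carrier = {P. partition_on A P}, eq = (=),
             le = (\<lambda>P Q. eqrel_of P \<subseteq> eqrel_of Q)\<rparr>"

definition sublattice_of :: "('a, 'b) gorder_scheme \<Rightarrow> 'a set \<Rightarrow> bool" where
  "sublattice_of L S \<longleftrightarrow> S \<subseteq> carrier L \<and>
     (\<forall>x\<in>S. \<forall>y\<in>S. x \<squnion>\<^bsub>L\<^esub> y \<in> S \<and> x \<sqinter>\<^bsub>L\<^esub> y \<in> S)"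

definition generating_set :: "('a, 'b) gorder_scheme \<Rightarrow> 'a set \<Rightarrow> bool" where
  "generating_set L X \<longleftrightarrow> X \<subseteq> carrier L \<and>
     \<not> (\<exists>S. sublattice_of L S \<and> S \<noteq> carrier L \<and> X \<subseteq> S)"

definition height_one :: "'a set \<Rightarrow> 'a set set \<Rightarrow> bool" where
  "height_one A P \<longleftrightarrow> P \<in> carrier (PLat A) \<and>
     (\<exists>B\<in>P. card B = 2 \<and> (\<forall>C\<in>P. C \<noteq> B \<longrightarrow> card C = 1))"

definition height_two :: "'a set \<Rightarrow> 'a set set \<Rightarrow> bool" where
  "height_two A P \<longleftrightarrow>
     (\<exists>Q R. height_one A Q \<and> height_one A R \<and> Q \<noteq> R \<and> P = Q \<squnion>\<^bsub>PLat A\<^esub> R)"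

text \<open>The operations \<open>\<squnion>\<close> and \<open>\<sqinter>\<close> above are chosen by Hilbert's operator;
  they are the genuine suprema and infima because \<open>PLat A\<close> is a lattice.\<close>

lemma equiv_eqrel_of: "partition_on A P \<Longrightarrow> equiv A (eqrel_of P)"
  unfolding eqrel_of_def using equiv_partition_on by (simp add: Bex_def conj_ac)

lemma quotient_eqrel_of: "partition_on A P \<Longrightarrow> A // eqrel_of P = P"
  unfolding eqrel_of_def using partition_on_eq_quotient by (simp add: Bex_def conj_ac)

lemma eqrel_of_quotient:
  assumes "equiv A r" shows "eqrel_of (A // r) = r"
proof
  show "eqrel_of (A // r) \<subseteq> r"
    unfolding eqrel_of_def using assms quotient_eq_iff[OF assms] by blast
  show "r \<subseteq> eqrel_of (A // r)"
  proof
    fix z assume z: "z \<in> r"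
    obtain x y where xy: "z = (x, y)" by force
    have "x \<in> A" "x \<in> r `` {x}" "y \<in> r `` {x}"
      using z xy assms by (auto simp: equiv_def refl_on_def)
    then show "z \<in> eqrel_of (A // r)"
      unfolding eqrel_of_def xy by (auto intro: quotientI)
  qed
qed

lemma eqrel_of_inject:
  "partition_on A P \<Longrightarrow> partition_on A Q \<Longrightarrow> eqrel_of P = eqrel_of Q \<Longrightarrow> P = Q"
  by (metis quotient_eqrel_of)

lemma equiv_trancl_Un:
  assumes "equiv A r" "equiv A s" shows "equiv A ((r \<union> s)\<^sup>+)"
proof (rule equivI)
  have sub: "r \<union> s \<subseteq> A \<times> A" using assms by (auto simp: equiv_def)
  show "(r \<union> s)\<^sup>+ \<subseteq> A \<times> A" by (rule trancl_subset_Sigma[OF sub])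
  show "refl_on A ((r \<union> s)\<^sup>+)"
    using assms by (auto simp: equiv_def refl_on_def)
  show "sym ((r \<union> s)\<^sup>+)"
    using assms by (auto simp: equiv_def intro: sym_trancl sym_Un)
  show "trans ((r \<union> s)\<^sup>+)" by (rule trans_trancl)
qed

lemma equiv_Int:
  assumes "equiv A r" "equiv A s" shows "equiv A (r \<inter> s)"
  using assms by (auto simp: equiv_def refl_on_def intro: sym_Int trans_Int)

lemma least_PLat:
  assumes P: "partition_on A P" and Q: "partition_on A Q"
  shows "least (PLat A) (A // (eqrel_of P \<union> eqrel_of Q)\<^sup>+) (Upper (PLat A) {P, Q})"
proof -
  let ?r = "eqrel_of P" and ?s = "eqrel_of Q"
  note j = equiv_trancl_Un[OF equiv_eqrel_of[OF P] equiv_eqrel_of[OF Q]]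
  have "(?r \<union> ?s)\<^sup>+ \<subseteq> eqrel_of U"
    if U: "partition_on A U" and sub: "?r \<subseteq> eqrel_of U" "?s \<subseteq> eqrel_of U" for U
  proof -
    have "trans (eqrel_of U)" using equiv_eqrel_of[OF U] by (simp add: equiv_def)
    then have "(eqrel_of U)\<^sup>+ = eqrel_of U" by (rule trancl_id)
    then show ?thesis using sub trancl_mono[of _ "?r \<union> ?s" "eqrel_of U"] by blast
  qed
  then show ?thesis
    using P Q j
    by (auto simp: least_def Upper_def PLat_def partition_on_quotient eqrel_of_quotient)
qed

lemma greatest_PLat:
  assumes P: "partition_on A P" and Q: "partition_on A Q"
  shows "greatest (PLat A) (A // (eqrel_of P \<inter> eqrel_of Q)) (Lower (PLat A) {P, Q})"
  using P Q equiv_Int[OF equiv_eqrel_of[OF P] equiv_eqrel_of[OF Q]]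
  by (auto simp: greatest_def Lower_def PLat_def partition_on_quotient eqrel_of_quotient)

lemma lattice_PLat: "lattice (PLat A)"
proof -
  have car: "carrier (PLat A) = {P. partition_on A P}" by (simp add: PLat_def)
  have "partial_order (PLat A)"
    by unfold_locales (auto simp: PLat_def dest: eqrel_of_inject)
  then show ?thesis
    by (auto intro: least_PLat greatest_PLat simp: lattice_def upper_semilattice_def lower_semilattice_def
        upper_semilattice_axioms_def lower_semilattice_axioms_def car)
qed

end

theory Submission
  imports Defs
begin

text \<open>
  Enumerate the base set as a path \<open>0, 1, \<dots>, n - 1\<close>. Besides \<open>\<alpha>\<close>, take the two alternating
  matchings of the path and the partition into even and odd indices. If a sublattice containing
  these three contains all atoms within \<open>{..m}\<close>, \<open>m \<ge> 3\<close>, then joining such an atom with a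
  matching and intersecting with the parity partition or the other matching produces atoms
  involving \<open>m + 1\<close>, so that by induction it contains all atoms. It remains to number the base set
  such that \<open>\<alpha>\<close> yields the atoms within \<open>{0, 1, 2, 3}\<close>: this works for the blocks
  \<open>{0, 1, 3}\<close>, and if \<open>n \<ge> 5\<close> also for \<open>{0, 3}\<close> and \<open>{0, 1}, {2, 4}\<close>. For \<open>n = 4\<close>, the atoms
  \<open>{0, 3}\<close>, \<open>{0, 1}\<close>, \<open>{1, 2}\<close> together with \<open>{0, 2}, {1, 3}\<close> settle the last two types.
  Only joins with atoms occur, and these have an explicit description (\<open>glue\<close>).
\<close>

section \<open>Joins of an equivalence relation with an atom\<close>

definition atom_rel :: "'a set \<Rightarrow> 'a \<Rightarrow> 'a \<Rightarrow> 'a rel" where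
  "atom_rel A u v = {(a, b). a \<in> A \<and> b \<in> A \<and> (a = b \<or> a = u \<and> b = v \<or> a = v \<and> b = u)}"

text \<open>For an equivalence \<open>r\<close> this merges the classes of \<open>u\<close> and
  \<open>v\<close> into one and keeps all other classes.\<close>

definition glue :: "'a \<Rightarrow> 'a \<Rightarrow> 'a rel \<Rightarrow> 'a rel" where
  "glue u v r = {(a, b). (a, b) \<in> r \<or>
     ((a, u) \<in> r \<or> (a, v) \<in> r) \<and> ((b, u) \<in> r \<or> (b, v) \<in> r)}"

lemma equivD:
  assumes "equiv A r"
  shows "r \<subseteq> A \<times> A" "a \<in> A \<Longrightarrow> (a, a) \<in> r" "(a, b) \<in> r \<Longrightarrow> (b, a) \<in> r"
    "(a, b) \<in> r \<Longrightarrow> (b, c) \<in> r \<Longrightarrow> (a, c) \<in> r"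
  using assms by (auto simp: equiv_def refl_on_def dest: symD transD)

lemma atom_rel_commute: "atom_rel A u v = atom_rel A v u"
  by (auto simp: atom_rel_def)

text \<open>\<open>glue u v r\<close> is transitive and contains both relations, hence their
  closure. Conversely, each new pair is reached by an \<open>r\<close>-step to \<open>u\<close> or
  \<open>v\<close>, a possible crossing of the atom, and another \<open>r\<close>-step.\<close>

lemma trancl_Un_atom_rel:
  assumes r: "equiv A r" and uv: "u \<in> A" "v \<in> A"
  shows "(r \<union> atom_rel A u v)\<^sup>+ = glue u v r"
proof
  note D = equivD[OF r]
  have "trans (glue u v r)"
    by (rule transI) (use D(3,4) in \<open>unfold glue_def, blast\<close>)
  moreover have "r \<union> atom_rel A u v \<subseteq> glue u v r"
    using D(1) D(2) uv by (auto simp: atom_rel_def glue_def)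
  ultimately show "(r \<union> atom_rel A u v)\<^sup>+ \<subseteq> glue u v r"
    by (metis trancl_id trancl_mono_subset)
  let ?t = "(r \<union> atom_rel A u v)\<^sup>+"
  have sub: "r \<subseteq> ?t" by auto
  have e: "(u, v) \<in> ?t" "(v, u) \<in> ?t" using uv by (auto simp: atom_rel_def)
  show "glue u v r \<subseteq> ?t"
  proof (rule subrelI)
    fix a b assume "(a, b) \<in> glue u v r"
    then consider "(a, b) \<in> r"
      | c d where "c \<in> {u, v}" "d \<in> {u, v}" "(a, c) \<in> r" "(d, b) \<in> r"
      using D(3) unfolding glue_def by blast
    then show "(a, b) \<in> ?t"
    proof cases
      case 2
      have "(c, d) \<in> ?t \<or> c = d" using 2(1,2) e by auto
      moreover have "(a, c) \<in> ?t" "(d, b) \<in> ?t" using 2 sub by auto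
      ultimately show ?thesis by (metis trancl_trans)
    qed auto
  qed
qed

lemma equiv_atom_rel: "equiv A (atom_rel A u v)"
  by (auto simp: equiv_def refl_on_def sym_def trans_def atom_rel_def)

section \<open>Families closed under meets and under joins with atoms\<close>

text \<open>These are the closure properties of a sublattice that the argument uses, stated for
  relations; joins enter only when one side is an atom in \<open>T\<close>.\<close>

locale equiv_family =
  fixes A :: "'a set" and T :: "'a rel set"
  assumes equiv: "r \<in> T \<Longrightarrow> equiv A r"
    and Int: "r \<in> T \<Longrightarrow> s \<in> T \<Longrightarrow> r \<inter> s \<in> T"
    and glue: "r \<in> T \<Longrightarrow> atom_rel A u v \<in> T \<Longrightarrow> u \<in> A \<Longrightarrow> v \<in> A \<Longrightarrow> glue u v r \<in> T"
begin

text \<open>The condition \<open>u \<noteq> v\<close> leaves out the identity relation, whose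
  membership in \<open>T\<close> is derived separately in \<open>Id_on_mem\<close>.\<close>

definition complete_on :: "'a set \<Rightarrow> bool" where
  "complete_on V \<longleftrightarrow> V \<subseteq> A \<and> (\<forall>u\<in>V. \<forall>v\<in>V. u \<noteq> v \<longrightarrow> atom_rel A u v \<in> T)"

lemma complete_onD: "complete_on V \<Longrightarrow> u \<in> V \<Longrightarrow> v \<in> V \<Longrightarrow> u \<noteq> v \<Longrightarrow> atom_rel A u v \<in> T"
  by (simp add: complete_on_def)

text \<open>For another point \<open>k\<close> of \<open>V\<close>, the blocks {k, i, w} and {k, j,
  w} are joins of available atoms, and they meet exactly in {k, w}. So two atoms at a new point
  \<open>w\<close> yield all of them.\<close>

lemma complete_on_insert:
  assumes V: "complete_on V" and ij: "i \<in> V" "j \<in> V" "i \<noteq> j" and w: "w \<in> A"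
    and iw: "atom_rel A i w \<in> T" and jw: "atom_rel A j w \<in> T"
  shows "complete_on (insert w V)"
proof (cases "w \<in> V")
  case False
  have "atom_rel A k w \<in> T" if k: "k \<in> V" for k
  proof (cases "k = i \<or> k = j")
    case False
    have A: "i \<in> A" "j \<in> A" "k \<in> A" using V ij k by (auto simp: complete_on_def)
    have "glue i w (atom_rel A k i) \<in> T" "glue j w (atom_rel A k j) \<in> T"
      using V ij k iw jw False A w by (auto intro!: glue complete_onD)
    then have "glue i w (atom_rel A k i) \<inter> glue j w (atom_rel A k j) \<in> T" by (rule Int)
    also have "glue i w (atom_rel A k i) \<inter> glue j w (atom_rel A k j) = atom_rel A k w"
      using False A w ij k \<open>w \<notin> V\<close> unfolding glue_def atom_rel_def by auto
    finally show ?thesis .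
  qed (use iw jw in auto)
  then have "atom_rel A k w \<in> T" "atom_rel A w k \<in> T" if "k \<in> V" for k
    using that atom_rel_commute[of A w k] by auto
  then show ?thesis
    using V w unfolding complete_on_def by auto
qed (use V in \<open>simp add: insert_absorb\<close>)

text \<open>Take a maximal member \<open>s\<close> of \<open>T\<close> below \<open>r\<close>, which
  exists because the identity is a candidate and \<open>r\<close> is finite. Gluing along a pair of
  \<open>r\<close> stays below \<open>r\<close>, so by maximality that pair already lies in
  \<open>s\<close>.\<close>

lemma equiv_mem:
  assumes fin: "finite A" and all: "complete_on A" and bot: "Id_on A \<in> T" and r: "equiv A r"
  shows "r \<in> T"
proof -
  have finr: "finite r" using equivD(1)[OF r] fin by (meson finite_SigmaI finite_subset)
  have "finite {s \<in> T. s \<subseteq> r}" using finr by (simp add: finite_subset[of _ "Pow r"] Collect_mono_iff subset_eq)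
  moreover have "Id_on A \<in> {s \<in> T. s \<subseteq> r}" using bot equivD(2)[OF r] by auto
  ultimately obtain s where s: "s \<in> T" "s \<subseteq> r" and max: "\<And>t. t \<in> T \<Longrightarrow> t \<subseteq> r \<Longrightarrow> s \<subseteq> t \<Longrightarrow> s = t"
    by (metis (no_types, lifting) empty_iff finite_has_maximal mem_Collect_eq)
  note D = equivD[OF r] and E = equivD[OF equiv[OF s(1)]]
  have "(u, v) \<in> s" if uv: "(u, v) \<in> r" for u v
  proof (cases "u = v")
    case True
    then show ?thesis using uv D(1) E(2) by auto
  next
    case False
    have A: "u \<in> A" "v \<in> A" using uv D(1) by auto
    have "glue u v s \<in> T" using False A s all by (auto intro: glue complete_onD)
    moreover have "glue u v s \<subseteq> r" using uv s(2) D(3,4) unfolding glue_def by blast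
    moreover have "s \<subseteq> glue u v s" unfolding glue_def by auto
    moreover have "(u, v) \<in> glue u v s" using E(2) A unfolding glue_def by auto
    ultimately show ?thesis using max by metis
  qed
  then have "r = s" using s(2) by auto
  then show ?thesis using s by simp
qed

text \<open>Two atoms sharing exactly one point meet in the identity.\<close>

lemma Id_on_mem:
  assumes "complete_on {u, v, w}" "u \<noteq> v" "v \<noteq> w" "u \<noteq> w"
  shows "Id_on A \<in> T"
proof -
  have "atom_rel A u v \<inter> atom_rel A v w \<in> T" using assms by (auto intro: Int complete_onD)
  also have "atom_rel A u v \<inter> atom_rel A v w = Id_on A" using assms by (auto simp: atom_rel_def)
  finally show ?thesis .
qed

end

section \<open>Alternating matchings of a path, and the parity partition\<close>

definition even_edges :: "nat \<Rightarrow> nat rel" where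
  "even_edges n = {(i, j). i < n \<and> j < n \<and> (i = j \<or> even i \<and> j = Suc i \<or> even j \<and> i = Suc j)}"

text \<open>Unlike in \<open>even_edges\<close>, index 0 is always a singleton block here;
  \<open>step_odd\<close> and \<open>prefix_edges\<close> rely on this.\<close>

definition odd_edges :: "nat \<Rightarrow> nat rel" where
  "odd_edges n = {(i, j). i < n \<and> j < n \<and> (i = j \<or> odd i \<and> j = Suc i \<or> odd j \<and> i = Suc j)}"

definition parity :: "nat \<Rightarrow> nat rel" where
  "parity n = {(i, j). i < n \<and> j < n \<and> even i = even j}"

lemmas rel_defs = even_edges_def odd_edges_def parity_def glue_def atom_rel_def

lemma equiv_even_edges: "equiv {..<n} (even_edges n)"
  and equiv_odd_edges: "equiv {..<n} (odd_edges n)"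
  and equiv_parity: "equiv {..<n} (parity n)"
  by (auto simp: equiv_def refl_on_def sym_def trans_def rel_defs)

locale zigzag = equiv_family "{..<n}" T for n :: nat and T +
  assumes even_edges: "even_edges n \<in> T"
    and odd_edges: "odd_edges n \<in> T"
    and parity: "parity n \<in> T"
begin

abbreviation "at \<equiv> atom_rel {..<n}"

text \<open>As 0 is unmatched in \<open>odd_edges\<close>, gluing it to \<open>m\<close> creates the
  block {0, m, m + 1}, of which parity keeps only {0, m + 1}. Then {0, m, m + 1} meets
  \<open>odd_edges\<close> in {m, m + 1}, the second atom at the new point.\<close>

lemma step_odd:
  assumes V: "complete_on {..m}" and m: "odd m" "3 \<le> m" "Suc m < n"
  shows "complete_on {..Suc m}"
proof -
  have 0: "at 0 m \<in> T" using V m by (auto intro: complete_onD)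
  have "glue 0 m (odd_edges n) \<inter> parity n \<in> T"
    using 0 m by (intro Int glue odd_edges parity) auto
  also have "glue 0 m (odd_edges n) \<inter> parity n = at 0 (Suc m)"
    using m by (auto simp: rel_defs)
  finally have 1: "at 0 (Suc m) \<in> T" .
  then have "glue 0 m (at 0 (Suc m)) \<inter> odd_edges n \<in> T"
    using 0 m by (intro Int glue odd_edges) auto
  also have "glue 0 m (at 0 (Suc m)) \<inter> odd_edges n = at m (Suc m)"
    using m by (auto simp: rel_defs)
  finally show ?thesis
    using complete_on_insert[OF V _ _ _ _ 1, of m] m by (simp add: atMost_Suc)
qed

text \<open>Both ends of a gluing are now matched, so one join yields four points at once. Two such
  blocks {i, i + 1, m, m + 1}, for \<open>i = 0\<close> and \<open>i = 2\<close>, meet in {m, m +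
  1}; keeping {0, 1, 2, 3} apart from \<open>m\<close> requires \<open>4 \<le> m\<close>.\<close>

lemma step_even:
  assumes V: "complete_on {..m}" and m: "even m" "4 \<le> m" "Suc m < n"
  shows "complete_on {..Suc m}"
proof -
  define B where "B i = {(a, b). a < n \<and> b < n \<and>
    (a = b \<or> a \<in> {i, Suc i, m, Suc m} \<and> b \<in> {i, Suc i, m, Suc m})}" for i
  have B: "B i \<in> T" if i: "even i" "Suc i < m" for i
  proof -
    let ?C = "{(a, b). a < n \<and> b < n \<and>
      (a = b \<or> a \<in> {i, m} \<and> b \<in> {i, m} \<or> a \<in> {Suc i, Suc m} \<and> b \<in> {Suc i, Suc m})}"
    \<comment> \<open>Parity splits the four-point block into {i, m} and {i + 1, m + 1} and destroys
      all other edges. Gluing \<open>i\<close> to \<open>i + 1\<close> afterwards restores the block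
      alone.\<close>
    have "glue i m (even_edges n) \<inter> parity n \<in> T"
      using m i by (intro Int glue even_edges parity complete_onD[OF V]) auto
    also have "glue i m (even_edges n) \<inter> parity n = ?C"
      using m i by (auto simp: rel_defs)
    finally have "glue i (Suc i) ?C \<in> T"
      using m i by (intro glue complete_onD[OF V]) auto
    also have "glue i (Suc i) ?C = B i" using m i by (auto simp: glue_def B_def)
    finally show ?thesis .
  qed
  have "B 0 \<inter> B 2 \<in> T" using m by (intro Int B) auto
  also have "B 0 \<inter> B 2 = at m (Suc m)" using m by (auto simp: B_def atom_rel_def)
  finally have 1: "at m (Suc m) \<in> T" .
  have "glue 1 m (at m (Suc m)) \<inter> parity n \<in> T"
    using 1 m complete_onD[OF V, of 1 m] by (intro Int glue parity) auto
  also have "glue 1 m (at m (Suc m)) \<inter> parity n = at 1 (Suc m)"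
    using m by (auto simp: rel_defs)
  finally show ?thesis
    using complete_on_insert[OF V _ _ _ _ 1, of 1] m by (simp add: atMost_Suc)
qed

lemma complete_on_all:
  assumes "complete_on {..3}" "4 \<le> n"
  shows "complete_on {..<n}"
proof -
  have "m < n \<Longrightarrow> complete_on {..m}" if "3 \<le> m" for m
    using that
  proof (induction m rule: dec_induct)
    case base
    then show ?case using assms by simp
  next
    case (step m)
    then show ?case
      \<comment> \<open>The value 3 is odd; every later \<open>m\<close> is at least 4, as
        \<open>step_even\<close> demands.\<close>
      using step_odd[of m] step_even[of m] by (cases "m = 3") auto
  qed
  from this[of "n - 1"] show ?thesis using assms(2)
    by (cases n) (auto simp: lessThan_Suc_atMost)
qed

text \<open>The indices \<open>i\<close> and \<open>j\<close> are left open because different atoms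
  at 3 are at hand for the different types of generator.\<close>

lemma complete_on_3I:
  assumes "4 \<le> n" "at 0 1 \<in> T" "at 1 2 \<in> T" "at 0 2 \<in> T"
    and "i \<le> 2" "j \<le> 2" "i \<noteq> j" "at i 3 \<in> T" "at j 3 \<in> T"
  shows "complete_on {..3}"
proof -
  have "complete_on {0, 1, 2}"
    using assms(1-4) unfolding complete_on_def by (auto simp: atom_rel_commute)
  moreover have "i \<in> {0, 1, 2}" "j \<in> {0, 1, 2}" using assms by auto
  moreover have "insert 3 {0, 1, 2} = {..3::nat}" by auto
  ultimately show ?thesis using complete_on_insert[of "{0, 1, 2}" i j 3] assms by simp
qed

text \<open>The block {0, 1, 2} meets parity in {0, 2}; gluing 0 to 2 in \<open>even_edges\<close>
  gives {0, 1, 2, 3}, which meets \<open>odd_edges\<close> in {1, 2}.\<close>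

lemma prefix_edges:
  assumes n: "4 \<le> n" and 01: "at 0 1 \<in> T"
  shows "at 0 2 \<in> T" "at 1 2 \<in> T"
proof -
  have "glue 0 1 (odd_edges n) \<inter> parity n \<in> T"
    using 01 n by (intro Int glue odd_edges parity) auto
  also have "glue 0 1 (odd_edges n) \<inter> parity n = at 0 2"
    using n by (auto simp: rel_defs)
  finally show 02: "at 0 2 \<in> T" .
  have "glue 0 2 (even_edges n) \<inter> odd_edges n \<in> T"
    using 02 n by (intro Int glue even_edges odd_edges) auto
  also have "glue 0 2 (even_edges n) \<inter> odd_edges n = at 1 2"
    using n by (auto simp: rel_defs)
  finally show "at 1 2 \<in> T" .
qed

text \<open>The block {0, 1, 3} contains one path edge and one pair of equal parity, so
  \<open>even_edges\<close> and \<open>parity n\<close> extract two atoms from it.\<close>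

lemma complete_on_three_block:
  assumes n: "4 \<le> n" and s: "glue 1 3 (at 0 1) \<in> T"
  shows "complete_on {..<n}"
proof -
  have "glue 1 3 (at 0 1) \<inter> even_edges n \<in> T" using s even_edges by (rule Int)
  also have "glue 1 3 (at 0 1) \<inter> even_edges n = at 0 1"
    using n by (auto simp: rel_defs)
  finally have 01: "at 0 1 \<in> T" .
  have "glue 1 3 (at 0 1) \<inter> parity n \<in> T" using s parity by (rule Int)
  also have "glue 1 3 (at 0 1) \<inter> parity n = at 1 3"
    using n by (auto simp: rel_defs)
  finally have 13: "at 1 3 \<in> T" .
  note 012 = prefix_edges[OF n 01]
  have "glue 1 3 (at 1 2) \<inter> even_edges n \<in> T"
    using 13 012 n by (intro Int glue even_edges) auto
  also have "glue 1 3 (at 1 2) \<inter> even_edges n = at 2 3"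
    using n by (auto simp: rel_defs)
  finally have "at 2 3 \<in> T" .
  with 01 012 13 n show ?thesis by (intro complete_on_all complete_on_3I[of 1 2]) auto
qed

text \<open>The blocks {0, 1} and {2, 4} are separated by meeting with \<open>even_edges\<close> and
  with \<open>parity n\<close>, respectively.\<close>

lemma complete_on_two_blocks:
  assumes n: "5 \<le> n" and s: "glue 2 4 (at 0 1) \<in> T"
  shows "complete_on {..<n}"
proof -
  have "glue 2 4 (at 0 1) \<inter> even_edges n \<in> T" using s even_edges by (rule Int)
  also have "glue 2 4 (at 0 1) \<inter> even_edges n = at 0 1"
    using n by (auto simp: rel_defs)
  finally have 01: "at 0 1 \<in> T" .
  have "glue 2 4 (at 0 1) \<inter> parity n \<in> T" using s parity by (rule Int)
  also have "glue 2 4 (at 0 1) \<inter> parity n = at 2 4"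
    using n by (auto simp: rel_defs)
  finally have 24: "at 2 4 \<in> T" .
  have 012: "at 0 2 \<in> T" "at 1 2 \<in> T" using prefix_edges 01 n by auto
  \<comment> \<open>Joining the edges {1, 2} and {3, 4} gives {1, 2, 3, 4}, whose only even edge is
    {2, 3}.\<close>
  have "glue 2 4 (odd_edges n) \<inter> even_edges n \<in> T"
    using 24 n by (intro Int glue odd_edges even_edges) auto
  also have "glue 2 4 (odd_edges n) \<inter> even_edges n = at 2 3"
    using n by (auto simp: rel_defs)
  finally have 23: "at 2 3 \<in> T" .
  then have "glue 2 3 (at 1 2) \<inter> parity n \<in> T"
    using 012 n by (intro Int glue parity) auto
  also have "glue 2 3 (at 1 2) \<inter> parity n = at 1 3"
    using n by (auto simp: rel_defs)
  finally have "at 1 3 \<in> T" .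
  with 01 012 23 n show ?thesis by (intro complete_on_all complete_on_3I[of 1 2]) auto
qed

text \<open>The isolated block {0, 1, 2, 3}, called \<open>F\<close>, serves as a window: meeting
  with it discards everything outside the first four indices. Index 4 is used as an auxiliary
  point.\<close>

lemma complete_on_atom:
  assumes n: "5 \<le> n" and 03: "at 0 3 \<in> T"
  shows "complete_on {..<n}"
proof -
  have "glue 0 3 (odd_edges n) \<inter> parity n \<in> T"
    using 03 n by (intro Int glue odd_edges parity) auto
  also have "glue 0 3 (odd_edges n) \<inter> parity n = at 0 4"
    using n by (auto simp: rel_defs)
  finally have 04: "at 0 4 \<in> T" .
  let ?C = "{(i, j). i < n \<and> j < n \<and> (i = j \<or> i \<in> {0, 2} \<and> j \<in> {0, 2} \<or> i \<in> {1, 3} \<and> j \<in> {1, 3})}"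
  define F where "F = {(i, j). i < n \<and> j < n \<and> (i = j \<or> i \<in> {0, 1, 2, 3} \<and> j \<in> {0, 1, 2, 3})}"
  have "glue 0 3 (even_edges n) \<inter> parity n \<in> T"
    using 03 n by (intro Int glue even_edges parity) auto
  also have "glue 0 3 (even_edges n) \<inter> parity n = ?C"
    using n by (auto simp: rel_defs)
  finally have "glue 0 3 ?C \<in> T" using 03 n by (intro glue) auto
  also have "glue 0 3 ?C = F" using n by (auto simp: glue_def F_def)
  finally have F: "F \<in> T" .
  have "F \<inter> odd_edges n \<in> T" using F odd_edges by (rule Int)
  also have "F \<inter> odd_edges n = at 1 2"
    using n by (auto simp: rel_defs F_def)
  finally have 12: "at 1 2 \<in> T" .
  have "glue 0 4 (at 0 3) \<inter> odd_edges n \<in> T"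
    using 03 04 n by (intro Int glue odd_edges) auto
  also have "glue 0 4 (at 0 3) \<inter> odd_edges n = at 3 4"
    using n by (auto simp: rel_defs)
  finally have 34: "at 3 4 \<in> T" .
  \<comment> \<open>For \<open>n = 5\<close> the bounds reduce {3, 5} to the singleton {3}, so this
    case needs no separate treatment.\<close>
  let ?D = "{(i, j). i < n \<and> j < n \<and> (i = j \<or> i \<in> {2, 4} \<and> j \<in> {2, 4} \<or> i \<in> {3, 5} \<and> j \<in> {3, 5})}"
  have "glue 3 4 (even_edges n) \<inter> parity n \<in> T"
    using 34 n by (intro Int glue even_edges parity) auto
  also have "glue 3 4 (even_edges n) \<inter> parity n = ?D"
    using n by (auto simp: rel_defs)
  finally have "glue 0 4 ?D \<inter> F \<in> T"
    using 04 F n by (intro Int glue) auto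
  \<comment> \<open>The block {0, 2, 4} loses 4 on meeting with \<open>F\<close>, and 5 is cut off
    from 3.\<close>
  also have "glue 0 4 ?D \<inter> F = at 0 2"
    using n by (auto simp: glue_def F_def atom_rel_def)
  finally have 02: "at 0 2 \<in> T" .
  then have "glue 0 2 (at 1 2) \<inter> even_edges n \<in> T"
    using 12 n by (intro Int glue even_edges) auto
  also have "glue 0 2 (at 1 2) \<inter> even_edges n = at 0 1"
    using n by (auto simp: rel_defs)
  finally have 01: "at 0 1 \<in> T" .
  then have "glue 0 1 (at 0 3) \<inter> parity n \<in> T"
    using 03 n by (intro Int glue parity) auto
  also have "glue 0 1 (at 0 3) \<inter> parity n = at 1 3"
    using n by (auto simp: rel_defs)
  finally have "at 1 3 \<in> T" .
  with 01 02 12 03 n show ?thesis by (intro complete_on_all complete_on_3I[of 0 1]) auto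
qed

end

section \<open>The four-element base set\<close>

text \<open>Replaces the two preceding lemmas that need index 4. It serves twice: the given
  partition may play the role of the atom {0, 3} or of \<open>parity 4\<close>.\<close>

lemma complete_on_four:
  assumes "equiv_family {..<4} T" and 03: "atom_rel {..<4} 0 3 \<in> T"
    and 01: "atom_rel {..<4} 0 1 \<in> T" and 12: "atom_rel {..<4} 1 2 \<in> T" and par: "parity 4 \<in> T"
  shows "equiv_family.complete_on {..<4} T {..<4}"
proof -
  interpret equiv_family "{..<4}" T by fact
  have "glue 0 1 (atom_rel {..<4} 1 2) \<inter> parity 4 \<in> T"
    using 01 12 par by (intro Int glue) auto
  also have "glue 0 1 (atom_rel {..<4} 1 2) \<inter> parity 4 = atom_rel {..<4} 0 2"
    by (auto simp: rel_defs)
  finally have 02: "atom_rel {..<4} 0 2 \<in> T" .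
  have "glue 0 1 (atom_rel {..<4} 0 3) \<inter> parity 4 \<in> T"
    using 01 03 par by (intro Int glue) auto
  also have "glue 0 1 (atom_rel {..<4} 0 3) \<inter> parity 4 = atom_rel {..<4} 1 3"
    by (auto simp: rel_defs)
  finally have 13: "atom_rel {..<4} 1 3 \<in> T" .
  have "complete_on {0, 1, 2}"
    using 01 02 12 unfolding complete_on_def by (auto simp: atom_rel_commute)
  then have "complete_on (insert 3 {0, 1, 2})"
    using complete_on_insert[of "{0, 1, 2}" 0 1 3] 03 13 by simp
  moreover have "insert 3 {0, 1, 2} = {..<4::nat}" by auto
  ultimately show ?thesis by simp
qed

section \<open>Transport between partitions and relations on indices\<close>

text \<open>The chosen supremum equals the explicit one because least upper bounds are unique in a
  partial order.\<close>

lemma eqrel_of_join: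
  assumes "partition_on A P" "partition_on A Q"
  shows "eqrel_of (P \<squnion>\<^bsub>PLat A\<^esub> Q) = (eqrel_of P \<union> eqrel_of Q)\<^sup>+"
proof -
  interpret lattice "PLat A" by (rule lattice_PLat)
  have "P \<squnion>\<^bsub>PLat A\<^esub> Q = A // (eqrel_of P \<union> eqrel_of Q)\<^sup>+"
    unfolding join_def sup_def using least_PLat[OF assms] by (metis least_unique someI)
  then show ?thesis
    using assms by (simp add: eqrel_of_quotient equiv_trancl_Un equiv_eqrel_of)
qed

lemma eqrel_of_meet:
  assumes "partition_on A P" "partition_on A Q"
  shows "eqrel_of (P \<sqinter>\<^bsub>PLat A\<^esub> Q) = eqrel_of P \<inter> eqrel_of Q"
proof -
  interpret lattice "PLat A" by (rule lattice_PLat)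
  have "P \<sqinter>\<^bsub>PLat A\<^esub> Q = A // (eqrel_of P \<inter> eqrel_of Q)"
    unfolding meet_def inf_def using greatest_PLat[OF assms] by (metis greatest_unique someI)
  then show ?thesis
    using assms by (simp add: eqrel_of_quotient equiv_Int equiv_eqrel_of)
qed

lemma mem_carrier_PLat [simp]: "P \<in> carrier (PLat A) \<longleftrightarrow> partition_on A P"
  by (simp add: PLat_def)

text \<open>The pullback along an enumeration \<open>x\<close> of the base set; it moves all
  computations to indices.\<close>

definition pull :: "nat \<Rightarrow> (nat \<Rightarrow> 'a) \<Rightarrow> 'a set set \<Rightarrow> nat rel" where
  "pull n x P = {(i, j). i < n \<and> j < n \<and> (x i, x j) \<in> eqrel_of P}"

context
  fixes n :: nat and x :: "nat \<Rightarrow> 'a" and A :: "'a set"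
  assumes bij: "bij_betw x {..<n} A"
begin

lemma enum_mem: "i < n \<Longrightarrow> x i \<in> A"
  and enum_eq_iff: "i < n \<Longrightarrow> j < n \<Longrightarrow> x i = x j \<longleftrightarrow> i = j"
  and enum_surj: "a \<in> A \<Longrightarrow> \<exists>i<n. a = x i"
  using bij by (auto simp: bij_betw_def inj_on_def)

lemma eqrel_of_eq_pull:
  assumes "partition_on A P"
  shows "eqrel_of P = {(x i, x j) |i j. (i, j) \<in> pull n x P}"
proof -
  have "\<exists>i j. a = x i \<and> b = x j \<and> i < n \<and> j < n" if "(a, b) \<in> eqrel_of P" for a b
    using that equivD(1)[OF equiv_eqrel_of[OF assms]] enum_surj by (meson mem_Sigma_iff subsetD)
  then show ?thesis unfolding pull_def by fastforce
qed

lemma pull_inject: "partition_on A P \<Longrightarrow> partition_on A Q \<Longrightarrow> pull n x P = pull n x Q \<Longrightarrow> P = Q"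
  by (rule eqrel_of_inject) (simp_all add: eqrel_of_eq_pull)

lemma equiv_pull:
  assumes "partition_on A P" shows "equiv {..<n} (pull n x P)"
proof -
  note D = equivD[OF equiv_eqrel_of[OF assms]]
  show ?thesis
  proof (rule equivI)
    show "refl_on {..<n} (pull n x P)" using D(2) enum_mem by (auto simp: pull_def refl_on_def)
    show "sym (pull n x P)" using D(3) by (auto simp: pull_def sym_def)
    show "trans (pull n x P)" using D(4) by (auto simp: pull_def intro!: transI)
  qed (auto simp: pull_def)
qed

text \<open>The image of \<open>r\<close> under \<open>x\<close> is an equivalence on
  \<open>A\<close>, transitive because \<open>x\<close> is injective. Together with
  \<open>pull_inject\<close> this makes \<open>pull\<close> a bijection onto the equivalences on
  indices.\<close>

lemma pull_quotient:
  assumes r: "equiv {..<n} r"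
  shows "\<exists>P. partition_on A P \<and> pull n x P = r"
proof -
  note D = equivD[OF r]
  let ?s = "{(x i, x j) |i j. (i, j) \<in> r}"
  have s: "equiv A ?s"
  proof (rule equivI)
    show "?s \<subseteq> A \<times> A" using D(1) enum_mem by auto
    show "refl_on A ?s" using D(2) enum_surj by (fastforce simp: refl_on_def)
    show "sym ?s" using D(3) by (auto simp: sym_def)
    show "trans ?s"
    proof (rule transI)
      fix a b c assume "(a, b) \<in> ?s" "(b, c) \<in> ?s"
      then obtain i j j' k where "a = x i" "b = x j" "(i, j) \<in> r" "b = x j'" "c = x k" "(j', k) \<in> r"
        by auto
      then show "(a, c) \<in> ?s" using D(1,4) enum_eq_iff[of j j'] by blast
    qed
  qed
  have "pull n x (A // ?s) = r"
    using D(1) enum_eq_iff unfolding pull_def eqrel_of_quotient[OF s] by auto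
  then show ?thesis using s partition_on_quotient by blast
qed

lemma pull_atom_rel:
  assumes "eqrel_of P = atom_rel A (x u) (x v)" "u < n" "v < n"
  shows "pull n x P = atom_rel {..<n} u v"
  using assms enum_mem enum_eq_iff unfolding pull_def by (auto simp: atom_rel_def)

lemma pull_glue:
  assumes "eqrel_of P = glue (x u) (x v) (eqrel_of Q)" "u < n" "v < n"
  shows "pull n x P = glue u v (pull n x Q)"
  using assms unfolding pull_def by (auto simp: glue_def)

lemma pull_glue_atom_rel:
  assumes "eqrel_of P = glue (x u) (x v) (atom_rel A (x i) (x j))"
    and "u < n" "v < n" "i < n" "j < n"
  shows "pull n x P = glue u v (atom_rel {..<n} i j)"
proof -
  have "eqrel_of (A // atom_rel A (x i) (x j)) = atom_rel A (x i) (x j)"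
    by (simp add: eqrel_of_quotient equiv_atom_rel)
  then show ?thesis using assms pull_glue pull_atom_rel by metis
qed

lemma eqrel_of_eq_atom_rel:
  assumes P: "partition_on A P" and "pull n x P = atom_rel {..<n} u v" "u < n" "v < n"
  shows "eqrel_of P = atom_rel A (x u) (x v)"
  unfolding eqrel_of_eq_pull[OF P] assms(2) using assms(3,4) enum_mem enum_surj
  by (fastforce simp: atom_rel_def)

text \<open>Meets pull back to intersections. For joins, the atom is first carried over to
  \<open>A\<close>, where \<open>trancl_Un_atom_rel\<close> turns the closure into
  \<open>glue\<close>.\<close>

lemma equiv_family_pull:
  assumes S: "sublattice_of (PLat A) S"
  shows "equiv_family {..<n} (pull n x ` S)"
proof
  have part: "partition_on A P" if "P \<in> S" for P
    using S that by (auto simp: sublattice_of_def)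
  show "equiv {..<n} r" if "r \<in> pull n x ` S" for r
    using that part equiv_pull by auto
  show "r \<inter> s \<in> pull n x ` S" if "r \<in> pull n x ` S" "s \<in> pull n x ` S" for r s
  proof -
    obtain P Q where PQ: "P \<in> S" "Q \<in> S" "r = pull n x P" "s = pull n x Q"
      using \<open>r \<in> _\<close> \<open>s \<in> _\<close> by auto
    have "r \<inter> s = pull n x (P \<sqinter>\<^bsub>PLat A\<^esub> Q)"
      using PQ part by (auto simp: pull_def eqrel_of_meet)
    then show ?thesis using PQ S by (auto simp: sublattice_of_def)
  qed
  show "glue u v r \<in> pull n x ` S"
    if h: "r \<in> pull n x ` S" "atom_rel {..<n} u v \<in> pull n x ` S" "u \<in> {..<n}" "v \<in> {..<n}" for r u v
  proof -
    obtain P Q where PQ: "P \<in> S" "Q \<in> S" "r = pull n x P" "pull n x Q = atom_rel {..<n} u v"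
      using h by force
    have "eqrel_of (P \<squnion>\<^bsub>PLat A\<^esub> Q) = (eqrel_of P \<union> atom_rel A (x u) (x v))\<^sup>+"
      using PQ part h eqrel_of_eq_atom_rel[of Q u v] by (simp add: eqrel_of_join)
    also have "\<dots> = glue (x u) (x v) (eqrel_of P)"
      using PQ part h enum_mem by (intro trancl_Un_atom_rel equiv_eqrel_of) auto
    finally have "pull n x (P \<squnion>\<^bsub>PLat A\<^esub> Q) = glue u v r"
      using h PQ pull_glue by auto
    then show ?thesis using PQ S unfolding sublattice_of_def by (metis image_eqI)
  qed
qed

text \<open>A sublattice including \<open>X\<close> pulls back to a family with all atoms, hence
  with all equivalences, and injectivity of \<open>pull\<close> returns every partition. Three
  indices are required for the identity.\<close>

lemma generating_setI:
  assumes n: "3 \<le> n" and X: "X \<subseteq> carrier (PLat A)"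
    and gen: "\<And>T. equiv_family {..<n} T \<Longrightarrow> pull n x ` X \<subseteq> T \<Longrightarrow>
      equiv_family.complete_on {..<n} T {..<n}"
  shows "generating_set (PLat A) X"
proof -
  have "S = carrier (PLat A)" if S: "sublattice_of (PLat A) S" "X \<subseteq> S" for S
  proof
    interpret equiv_family "{..<n}" "pull n x ` S" by (rule equiv_family_pull[OF S(1)])
    have all: "complete_on {..<n}" using gen[OF equiv_family_axioms] S(2) by auto
    then have "complete_on {0, 1, 2}" using n by (auto simp: complete_on_def)
    then have bot: "Id_on {..<n} \<in> pull n x ` S" by (rule Id_on_mem) auto
    show sub: "S \<subseteq> carrier (PLat A)" using S(1) by (simp add: sublattice_of_def)
    show "carrier (PLat A) \<subseteq> S"
    proof
      fix P assume P: "P \<in> carrier (PLat A)"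
      then have "pull n x P \<in> pull n x ` S" using equiv_mem[OF _ all bot equiv_pull] by simp
      then obtain Q where "Q \<in> S" "pull n x P = pull n x Q" by auto
      then show "P \<in> S" using sub P pull_inject[of P Q] by auto
    qed
  qed
  then show ?thesis using X unfolding generating_set_def by auto
qed

lemma ex_generating_set:
  assumes n: "3 \<le> n" and a: "\<alpha> \<in> carrier (PLat A)" and "distinct [pull n x \<alpha>, q, r, s]"
    and "equiv {..<n} q" "equiv {..<n} r" "equiv {..<n} s"
    and gen: "\<And>T. equiv_family {..<n} T \<Longrightarrow> {pull n x \<alpha>, q, r, s} \<subseteq> T \<Longrightarrow>
      equiv_family.complete_on {..<n} T {..<n}"
  shows "\<exists>\<beta> \<in> carrier (PLat A). \<exists>\<gamma> \<in> carrier (PLat A). \<exists>\<delta> \<in> carrier (PLat A).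
    card {\<alpha>, \<beta>, \<gamma>, \<delta>} = 4 \<and> generating_set (PLat A) {\<alpha>, \<beta>, \<gamma>, \<delta>}"
proof -
  obtain \<beta> \<gamma> \<delta> where *: "partition_on A \<beta>" "partition_on A \<gamma>" "partition_on A \<delta>"
    "pull n x \<beta> = q" "pull n x \<gamma> = r" "pull n x \<delta> = s"
    using assms pull_quotient by metis
  then have "distinct [\<alpha>, \<beta>, \<gamma>, \<delta>]" using assms(3) by auto
  then have "card {\<alpha>, \<beta>, \<gamma>, \<delta>} = 4" by auto
  moreover have "generating_set (PLat A) {\<alpha>, \<beta>, \<gamma>, \<delta>}"
    using * a gen by (intro generating_setI n) auto
  ultimately show ?thesis using * mem_carrier_PLat by blast
qed

lemma ex_generating_set_zigzag:
  assumes n: "4 \<le> n" and a: "\<alpha> \<in> carrier (PLat A)"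
    and ne: "pull n x \<alpha> \<noteq> even_edges n" "pull n x \<alpha> \<noteq> odd_edges n" "pull n x \<alpha> \<noteq> parity n"
    and gen: "\<And>T. zigzag n T \<Longrightarrow> pull n x \<alpha> \<in> T \<Longrightarrow>
      equiv_family.complete_on {..<n} T {..<n}"
  shows "\<exists>\<beta> \<in> carrier (PLat A). \<exists>\<gamma> \<in> carrier (PLat A). \<exists>\<delta> \<in> carrier (PLat A).
    card {\<alpha>, \<beta>, \<gamma>, \<delta>} = 4 \<and> generating_set (PLat A) {\<alpha>, \<beta>, \<gamma>, \<delta>}"
proof (rule ex_generating_set)
  \<comment> \<open>The pair (0, 1) separates \<open>even_edges n\<close> from the other two
    relations, and (0, 2) separates these from each other.\<close>
  have "(0, 1) \<in> even_edges n - odd_edges n" "(0, 1) \<notin> parity n" "(0, 2) \<in> parity n - odd_edges n"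
    using n by (auto simp: rel_defs)
  then show "distinct [pull n x \<alpha>, even_edges n, odd_edges n, parity n]" using ne by auto
  show "equiv_family.complete_on {..<n} T {..<n}"
    if "equiv_family {..<n} T" "{pull n x \<alpha>, even_edges n, odd_edges n, parity n} \<subseteq> T" for T
    using that by (intro gen) (auto simp: zigzag_def zigzag_axioms_def)
qed (use n a in \<open>auto intro: equiv_even_edges equiv_odd_edges equiv_parity\<close>)

end

section \<open>Enumerations with prescribed start, and the shapes of low partitions\<close>

lemma glue_commute: "glue u v r = glue v u r"
  by (auto simp: glue_def)

text \<open>Lets the points of the nontrivial blocks be placed at the indices that the generation
  lemmas expect.\<close>

lemma ex_enumeration:
  assumes "finite A" "distinct ys" "set ys \<subseteq> A"
  shows "\<exists>x. bij_betw x {..<card A} A \<and> (\<forall>i<length ys. x i = ys ! i)"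
proof -
  obtain zs where zs: "set zs = A - set ys" "distinct zs"
    using assms(1) finite_distinct_list[of "A - set ys"] by auto
  have *: "distinct (ys @ zs)" "set (ys @ zs) = A" using zs assms by auto
  then have "bij_betw ((!) (ys @ zs)) {..<card A} A"
    using distinct_card[OF *(1)] by (intro bij_betw_nth) auto
  then show ?thesis by (auto simp: nth_append intro!: exI[of _ "(!) (ys @ zs)"])
qed

lemma ex_not_mem_list:
  assumes "length ys < card A"
  shows "\<exists>p\<in>A. p \<notin> set ys"
proof (rule ccontr)
  assume "\<not> ?thesis"
  then have "card A \<le> card (set ys)" by (intro card_mono) auto
  then show False using card_length[of ys] assms by simp
qed

lemma height_one_eqrel_of:
  assumes "height_one A P"
  obtains u v where "u \<in> A" "v \<in> A" "u \<noteq> v" "eqrel_of P = atom_rel A u v"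
proof -
  obtain B where P: "partition_on A P" and B: "B \<in> P" "card B = 2"
    and C: "\<And>C. C \<in> P \<Longrightarrow> C \<noteq> B \<Longrightarrow> card C = 1"
    using assms by (auto simp: height_one_def)
  obtain u v where uv: "B = {u, v}" "u \<noteq> v" using B(2) by (meson card_2_iff)
  have A: "A = \<Union>P" using P by (rule partition_onD1)
  then have uA: "u \<in> A" "v \<in> A" using uv B(1) by auto
  have "eqrel_of P = atom_rel A u v"
  proof (rule subset_antisym; rule subrelI)
    fix a b assume "(a, b) \<in> eqrel_of P"
    then obtain D where D: "D \<in> P" "a \<in> D" "b \<in> D" by (auto simp: eqrel_of_def)
    moreover have "a = b" if "D \<noteq> B" using C[OF D(1) that] D by (auto simp: card_1_singleton_iff)
    ultimately show "(a, b) \<in> atom_rel A u v"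
      using uv A by (auto simp: atom_rel_def)
  next
    fix a b assume "(a, b) \<in> atom_rel A u v"
    then consider "a = b" "a \<in> A" | "a \<in> B" "b \<in> B" using uv by (auto simp: atom_rel_def)
    then show "(a, b) \<in> eqrel_of P"
      by cases (use A B(1) in \<open>auto simp: eqrel_of_def\<close>)
  qed
  then show thesis using that uA uv by blast
qed

text \<open>Two distinct atoms share one point or none; \<open>glue\<close> then has a block of
  three points or two blocks of two.\<close>

lemma height_two_eqrel_of:
  assumes "height_two A P"
  obtains (three_block) u v w where "{u, v, w} \<subseteq> A" "distinct [u, v, w]"
      "eqrel_of P = glue v w (atom_rel A u v)"
    | (two_blocks) u v w z where "{u, v, w, z} \<subseteq> A" "distinct [u, v, w, z]"
      "eqrel_of P = glue w z (atom_rel A u v)"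
proof -
  obtain Q R where QR: "height_one A Q" "height_one A R" "Q \<noteq> R" "P = Q \<squnion>\<^bsub>PLat A\<^esub> R"
    using assms by (auto simp: height_two_def)
  have part: "partition_on A Q" "partition_on A R" using QR by (auto simp: height_one_def)
  obtain a b where ab: "a \<in> A" "b \<in> A" "a \<noteq> b" "eqrel_of Q = atom_rel A a b"
    using QR(1) by (rule height_one_eqrel_of)
  obtain c d where cd: "c \<in> A" "d \<in> A" "c \<noteq> d" "eqrel_of R = atom_rel A c d"
    using QR(2) by (rule height_one_eqrel_of)
  have P: "eqrel_of P = glue c d (atom_rel A a b)"
    unfolding QR(4) eqrel_of_join[OF part] ab(4) cd(4)
    by (rule trancl_Un_atom_rel[OF equiv_atom_rel cd(1,2)])
  have "eqrel_of Q \<noteq> eqrel_of R" using QR(3) part eqrel_of_inject by blast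
  then have ne: "\<not> (a = c \<and> b = d)" "\<not> (a = d \<and> b = c)"
    unfolding ab(4) cd(4) using atom_rel_commute by metis+
  consider "a = c" | "a = d" | "b = c" | "b = d" | "distinct [a, b, c, d]" using ab(3) cd(3) by auto
  then show thesis
  proof cases
    case 1
    then show thesis using three_block[of b a d] ab cd ne P by (auto simp: atom_rel_commute)
  next
    case 2
    then show thesis using three_block[of b a c] ab cd ne P glue_commute atom_rel_commute
      by (metis (no_types, opaque_lifting) distinct_length_2_or_more distinct_singleton empty_subsetI insert_subset)
  next
    case 3
    then show thesis using three_block[of a b d] ab cd ne P by auto
  next
    case 4
    then show thesis using three_block[of a b c] ab cd ne P glue_commute[of c d] by auto
  next
    case 5
    then show thesis using two_blocks[of a b c d] ab cd P by auto
  qed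
qed

section \<open>Choice of the numbering for each type of partition\<close>

theorem theorem2p1:
  fixes n :: nat and \<alpha> :: "nat set set"
  assumes "n \<ge> 4"
    and "\<alpha> \<in> carrier (PLat {1..n})"
    and "height_one {1..n} \<alpha> \<or> height_two {1..n} \<alpha>"
  shows "\<exists>\<beta> \<in> carrier (PLat {1..n}). \<exists>\<gamma> \<in> carrier (PLat {1..n}). \<exists>\<delta> \<in> carrier (PLat {1..n}).
           card {\<alpha>, \<beta>, \<gamma>, \<delta>} = 4 \<and> generating_set (PLat {1..n}) {\<alpha>, \<beta>, \<gamma>, \<delta>}"
proof -
  let ?A = "{1..n}"
  have enum: "\<exists>x. bij_betw x {..<n} ?A \<and> (\<forall>i<length ys. x i = ys ! i)"
    if "distinct ys" "set ys \<subseteq> ?A" for ys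
    using ex_enumeration[OF _ that] by simp
  have new: "\<exists>p\<in>?A. p \<notin> set ys" if "length ys < n" for ys
    using that ex_not_mem_list[of ys ?A] by simp
  consider (atom) u v where "u \<in> ?A" "v \<in> ?A" "u \<noteq> v" "eqrel_of \<alpha> = atom_rel ?A u v"
    | (three_block) u v w where "{u, v, w} \<subseteq> ?A" "distinct [u, v, w]"
      "eqrel_of \<alpha> = glue v w (atom_rel ?A u v)"
    | (two_blocks) u v w z where "{u, v, w, z} \<subseteq> ?A" "distinct [u, v, w, z]"
      "eqrel_of \<alpha> = glue w z (atom_rel ?A u v)"
    using assms(3)
  proof
    assume "height_one ?A \<alpha>"
    then show thesis by (rule height_one_eqrel_of) (rule atom)
  next
    assume "height_two ?A \<alpha>"
    then show thesis by (rule height_two_eqrel_of) (fact three_block two_blocks)+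
  qed
  then show ?thesis
  proof cases
    case atom
    obtain p where p: "p \<in> ?A" "p \<notin> {u, v}" using new[of "[u, v]"] assms(1) by auto
    obtain q where q: "q \<in> ?A" "q \<notin> {u, v, p}" using new[of "[u, v, p]"] assms(1) by auto
    obtain x where x: "bij_betw x {..<n} ?A" "\<forall>i<4. x i = [u, p, q, v] ! i"
      using enum[of "[u, p, q, v]"] atom p q by auto
    have "x 0 = u" "x 3 = v" using x(2) by simp_all
    then have pull: "pull n x \<alpha> = atom_rel {..<n} 0 3"
      using atom assms(1) by (intro pull_atom_rel[OF x(1)]) auto
    show ?thesis
    proof (cases "n = 4")
      case False
      \<comment> \<open>Indices 0 and 3 are neither adjacent nor of equal parity, so this one pair
        tells \<alpha> apart from all three fixed generators.\<close>
      have "(0, 3) \<in> pull n x \<alpha>" using pull assms(1) by (auto simp: atom_rel_def)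
      moreover have "(0, 3) \<notin> even_edges n" "(0, 3) \<notin> odd_edges n" "(0, 3) \<notin> parity n"
        by (auto simp: rel_defs)
      ultimately show ?thesis using assms(1,2) False pull
        by (intro ex_generating_set_zigzag[OF x(1)]) (auto intro: zigzag.complete_on_atom)
    next
      case True
      have "(0, 3) \<in> pull n x \<alpha>" "(0, 3) \<notin> atom_rel {..<n} 0 1" "(0, 3) \<notin> atom_rel {..<n} 1 2"
        "(0, 3) \<notin> parity n" "(0, 1) \<in> atom_rel {..<n} 0 1" "(0, 1) \<notin> atom_rel {..<n} 1 2"
        "(0, 1) \<notin> parity n" "(1, 2) \<in> atom_rel {..<n} 1 2" "(1, 2) \<notin> parity n"
        unfolding pull using assms(1) by (auto simp: rel_defs)
      then have distinct: "distinct [pull n x \<alpha>, atom_rel {..<n} 0 1, atom_rel {..<n} 1 2, parity n]" by auto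
      show ?thesis
        by (rule ex_generating_set[OF x(1) _ assms(2) distinct])
          (use True pull in \<open>auto intro: complete_on_four equiv_parity equiv_atom_rel\<close>)
    qed
  next
    case three_block
    obtain p where p: "p \<in> ?A" "p \<notin> {u, v, w}" using new[of "[u, v, w]"] assms(1) by auto
    \<comment> \<open>The block goes to {0, 1, 3}; the outside point \<open>p\<close> fills index
      2.\<close>
    obtain x where x: "bij_betw x {..<n} ?A" "\<forall>i<4. x i = [u, v, p, w] ! i"
      using enum[of "[u, v, p, w]"] three_block p by auto
    have "x 0 = u" "x 1 = v" "x 3 = w" using x(2) by simp_all
    then have pull: "pull n x \<alpha> = glue 1 3 (atom_rel {..<n} 0 1)"
      using three_block assms(1) by (intro pull_glue_atom_rel[OF x(1)]) auto
    have "(0, 3) \<in> pull n x \<alpha>" using pull assms(1) by (auto simp: glue_def atom_rel_def)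
    moreover have "(0, 3) \<notin> even_edges n" "(0, 3) \<notin> odd_edges n" "(0, 3) \<notin> parity n"
      by (auto simp: rel_defs)
    ultimately show ?thesis using assms(1,2) pull
      by (intro ex_generating_set_zigzag[OF x(1)]) (auto intro: zigzag.complete_on_three_block)
  next
    case two_blocks
    show ?thesis
    proof (cases "n = 4")
      case False
      obtain p where p: "p \<in> ?A" "p \<notin> {u, v, w, z}"
        using new[of "[u, v, w, z]"] assms(1) False by auto
      \<comment> \<open>The blocks go to {0, 1} and {2, 4}, with a fifth point \<open>p\<close> at
        index 3.\<close>
      obtain x where x: "bij_betw x {..<n} ?A" "\<forall>i<5. x i = [u, v, w, p, z] ! i"
        using enum[of "[u, v, w, p, z]"] two_blocks p by auto
      have "x 0 = u" "x 1 = v" "x 2 = w" "x 4 = z" using x(2) by simp_all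
      then have pull: "pull n x \<alpha> = glue 2 4 (atom_rel {..<n} 0 1)"
        using two_blocks assms(1) False by (intro pull_glue_atom_rel[OF x(1)]) auto
      have "(0, 1) \<in> pull n x \<alpha>" "(2, 4) \<in> pull n x \<alpha>"
        using pull assms(1) False by (auto simp: glue_def atom_rel_def)
      moreover have "(2, 4) \<notin> even_edges n" "(0, 1) \<notin> odd_edges n" "(0, 1) \<notin> parity n"
        by (auto simp: rel_defs)
      ultimately show ?thesis using assms(1,2) False pull
        by (intro ex_generating_set_zigzag[OF x(1)]) (auto intro: zigzag.complete_on_two_blocks)
    next
      case True
      \<comment> \<open>Interleaving the two blocks turns \<alpha> into the parity partition, so the
        three atoms of \<open>complete_on_four\<close> are the new generators.\<close>
      obtain x where x: "bij_betw x {..<n} ?A" "\<forall>i<4. x i = [u, w, v, z] ! i"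
        using enum[of "[u, w, v, z]"] two_blocks by auto
      have "x 0 = u" "x 1 = w" "x 2 = v" "x 3 = z" using x(2) by simp_all
      then have "pull n x \<alpha> = glue 1 3 (atom_rel {..<n} 0 2)"
        using two_blocks True by (intro pull_glue_atom_rel[OF x(1)]) auto
      also have "\<dots> = parity n" unfolding True by (auto simp: rel_defs; presburger)
      finally have pull: "pull n x \<alpha> = parity n" .
      have "(0, 3) \<in> atom_rel {..<n} 0 3" "(0, 3) \<notin> atom_rel {..<n} 0 1" "(0, 3) \<notin> atom_rel {..<n} 1 2"
        "(0, 3) \<notin> parity n" "(0, 1) \<in> atom_rel {..<n} 0 1" "(0, 1) \<notin> atom_rel {..<n} 1 2"
        "(0, 1) \<notin> parity n" "(1, 2) \<in> atom_rel {..<n} 1 2" "(1, 2) \<notin> parity n"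
        using assms(1) by (auto simp: rel_defs)
      then have distinct: "distinct [pull n x \<alpha>, atom_rel {..<n} 0 3, atom_rel {..<n} 0 1, atom_rel {..<n} 1 2]"
        unfolding pull by auto
      show ?thesis
        by (rule ex_generating_set[OF x(1) _ assms(2) distinct])
          (use True pull in \<open>auto intro: complete_on_four equiv_atom_rel\<close>)
    qed
  qed
qed

end
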